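(* Let $K$ be the fundamental group of the Klein bottle, $K=\langle x,y\mid x^{-1}yx=y^{-1}\rangle$. Then $\operatorname{Aut}(K)$ does not act faithfully on the space $LO(K)$ of left-invariant orderings of $K$, and $\operatorname{Out}(K)$ acts faithfully neither on the space $O(K)$ of bi-invariant orderings of $K$ nor on the set of $K$-conjugacy classes of elements of $LO(K)$.
   Context: A left-invariant ordering on a group $G$ is a total ordering $\leq$ on $G$ such that $a\leq b$ implies $ca\leq cb$ for all $a,b,c\in G$; it is bi-invariant if in addition $a\leq b$ implies $ac\leq bc$. $LO(G)$ and $O(G)$ denote the sets of left-invariant and bi-invariant orderings on $G$, respectively. $\operatorname{Aut}(G)$ acts on $LO(G)$ and on $O(G)$ by sending $\leq$ to $\leq_\phi$, where $g\leq_\phi h$ if and only if $\phi(g)\leq\phi(h)$. Inner automorphisms act trivially on $O(G)$, so $\operatorname{Out}(G)$ acts on $O(G)$. $G$ acts on $LO(G)$ through inner automorphisms, a conjugacy class in $LO(G)$ is an orbit of this action, and $\operatorname{Out}(G)$ acts on the set of conjugacy classes. If $O(G)$ is empty, the action on it is regarded as trivial. *)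

theory Defs
  imports "HOL-Algebra.Group_Action"
begin

section \<open>Group presentations\<close>

text \<open>
  A word over the generators of type \<open>'a\<close> is a list of letters; \<open>(a, True)\<close> stands for the
  generator \<open>a\<close> and \<open>(a, False)\<close> for its inverse. A set \<open>R\<close> of relations \<open>(l, r)\<close>, read
  \<open>l = r\<close>, presents the group of all words modulo the congruence generated by free
  cancellation and \<open>R\<close>.
\<close>

type_synonym 'a word = "('a \<times> bool) list"

inductive word_eq :: "('a word \<times> 'a word) set \<Rightarrow> 'a word \<Rightarrow> 'a word \<Rightarrow> bool"
  for R :: "('a word \<times> 'a word) set" where
  cancel: "word_eq R (u @ [(a, b), (a, \<not> b)] @ v) (u @ v)"
| relation: "(l, r) \<in> R \<Longrightarrow> word_eq R (u @ l @ v) (u @ r @ v)"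
| refl: "word_eq R u u"
| sym: "word_eq R u v \<Longrightarrow> word_eq R v u"
| trans: "word_eq R u v \<Longrightarrow> word_eq R v w \<Longrightarrow> word_eq R u w"

definition word_rel :: "('a word \<times> 'a word) set \<Rightarrow> 'a word rel" where
  "word_rel R = {(u, v). word_eq R u v}"

definition presented_group :: "('a word \<times> 'a word) set \<Rightarrow> 'a word set monoid" where
  "presented_group R =
    \<lparr>carrier = UNIV // word_rel R,
     mult = (\<lambda>A B. \<Union>u\<in>A. \<Union>v\<in>B. word_rel R `` {u @ v}),
     one = word_rel R `` {[]}\<rparr>"

lemma equiv_word_rel: "equiv UNIV (word_rel R)"
  unfolding word_rel_def
  by (intro equivI refl_onI symI transI) (auto intro: word_eq.intros)

lemma word_eq_context: "word_eq R u v \<Longrightarrow> word_eq R (p @ u @ q) (p @ v @ q)"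
proof (induction rule: word_eq.induct)
  case (cancel u a b v)
  show ?case using word_eq.cancel[of R "p @ u" a b "v @ q"] by simp
next
  case (relation l r u v)
  then show ?case using word_eq.relation[of l r R "p @ u" "v @ q"] by simp
qed (auto intro: word_eq.intros)

lemma word_eq_append: "word_eq R u u' \<Longrightarrow> word_eq R v v' \<Longrightarrow> word_eq R (u @ v) (u' @ v')"
  using word_eq_context[of R u u' "[]" v] word_eq_context[of R v v' u' "[]"]
  by (auto intro: word_eq.trans)

lemma word_class_eq_iff: "word_rel R `` {u} = word_rel R `` {v} \<longleftrightarrow> word_eq R u v"
  using eq_equiv_class_iff[OF equiv_word_rel, of u v R] by (simp add: word_rel_def)

lemma presented_group_mult:
  "word_rel R `` {u} \<otimes>\<^bsub>presented_group R\<^esub> word_rel R `` {v} = word_rel R `` {u @ v}"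
proof -
  have "word_rel R `` {u' @ v'} = word_rel R `` {u @ v}"
    if "u' \<in> word_rel R `` {u}" "v' \<in> word_rel R `` {v}" for u' v'
    using that unfolding word_class_eq_iff
    by (auto simp: word_rel_def intro: word_eq.sym word_eq_append)
  moreover have "u \<in> word_rel R `` {u}" "v \<in> word_rel R `` {v}"
    by (simp_all add: word_rel_def word_eq.refl)
  ultimately have "(\<Union>u'\<in>word_rel R `` {u}. \<Union>v'\<in>word_rel R `` {v}. word_rel R `` {u' @ v'}) =
      word_rel R `` {u @ v}"
    by blast
  then show ?thesis by (simp add: presented_group_def)
qed

fun word_inv :: "'a word \<Rightarrow> 'a word" where
  "word_inv [] = []"
| "word_inv ((a, b) # w) = word_inv w @ [(a, \<not> b)]"

lemma word_inv_left: "word_eq R (word_inv w @ w) []"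
proof (induction w rule: word_inv.induct)
  case (2 a b w)
  have "word_eq R (word_inv w @ [(a, \<not> b), (a, \<not> \<not> b)] @ w) (word_inv w @ w)"
    by (rule word_eq.cancel)
  then show ?case using 2 by (auto intro: word_eq.trans)
qed (simp add: word_eq.refl)

theorem group_presented_group: "group (presented_group R)"
proof -
  have carr: "carrier (presented_group R) = range (\<lambda>u. word_rel R `` {u})"
    by (auto simp: presented_group_def quotient_def)
  have one: "\<one>\<^bsub>presented_group R\<^esub> = word_rel R `` {[]}"
    by (simp add: presented_group_def)
  show ?thesis
  proof (rule groupI)
    fix x assume "x \<in> carrier (presented_group R)"
    then obtain u where u: "x = word_rel R `` {u}" using carr by auto
    have "word_rel R `` {word_inv u} \<otimes>\<^bsub>presented_group R\<^esub> x = \<one>\<^bsub>presented_group R\<^esub>"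
      unfolding u presented_group_mult one word_class_eq_iff by (rule word_inv_left)
    then show "\<exists>y\<in>carrier (presented_group R). y \<otimes>\<^bsub>presented_group R\<^esub> x = \<one>\<^bsub>presented_group R\<^esub>"
      using carr by auto
  qed (auto simp: carr one presented_group_mult)
qed

section \<open>The Klein bottle group\<close>

datatype klein_gen = X | Y

definition klein_bottle_group :: "klein_gen word set monoid" where
  "klein_bottle_group =
    presented_group {([(X, False), (Y, True), (X, True)], [(Y, False)])}"

lemma group_klein_bottle_group: "group klein_bottle_group"
  unfolding klein_bottle_group_def by (rule group_presented_group)

section \<open>Invariant orderings\<close>

definition left_orders :: "('a, 'b) monoid_scheme \<Rightarrow> 'a rel set" where
  "left_orders G = {r. linear_order_on (carrier G) r \<and>
     (\<forall>a\<in>carrier G. \<forall>b\<in>carrier G. \<forall>c\<in>carrier G.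
        (a, b) \<in> r \<longrightarrow> (c \<otimes>\<^bsub>G\<^esub> a, c \<otimes>\<^bsub>G\<^esub> b) \<in> r)}"

definition bi_orders :: "('a, 'b) monoid_scheme \<Rightarrow> 'a rel set" where
  "bi_orders G = {r \<in> left_orders G.
     \<forall>a\<in>carrier G. \<forall>b\<in>carrier G. \<forall>c\<in>carrier G.
        (a, b) \<in> r \<longrightarrow> (a \<otimes>\<^bsub>G\<^esub> c, b \<otimes>\<^bsub>G\<^esub> c) \<in> r}"

definition pull_order :: "('a, 'b) monoid_scheme \<Rightarrow> ('a \<Rightarrow> 'a) \<Rightarrow> 'a rel \<Rightarrow> 'a rel" where
  "pull_order G \<phi> r = {(g, h). g \<in> carrier G \<and> h \<in> carrier G \<and> (\<phi> g, \<phi> h) \<in> r}"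

section \<open>Automorphisms acting on orderings\<close>

definition inner_auto :: "('a, 'b) monoid_scheme \<Rightarrow> 'a \<Rightarrow> 'a \<Rightarrow> 'a" where
  "inner_auto G g = (\<lambda>h\<in>carrier G. g \<otimes>\<^bsub>G\<^esub> h \<otimes>\<^bsub>G\<^esub> inv\<^bsub>G\<^esub> g)"

definition OutGroup :: "('a, 'b) monoid_scheme \<Rightarrow> ('a \<Rightarrow> 'a) set monoid" where
  "OutGroup G = AutoGroup G Mod (inner_auto G ` carrier G)"

text \<open>
  Since \<open>pull_order G (\<phi> \<circ> \<psi>) = pull_order G \<psi> \<circ> pull_order G \<phi>\<close>, pulling back is a right
  action. The locale \<^locale>\<open>group_action\<close> describes left actions, and a right action of a group
  is a left action of the opposite group.
\<close>

definition opposite_group :: "('a, 'b) monoid_scheme \<Rightarrow> 'a monoid" where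
  "opposite_group G = \<lparr>carrier = carrier G, mult = (\<lambda>x y. y \<otimes>\<^bsub>G\<^esub> x), one = \<one>\<^bsub>G\<^esub>\<rparr>"

definition left_order_action :: "('a, 'b) monoid_scheme \<Rightarrow> ('a \<Rightarrow> 'a) \<Rightarrow> 'a rel \<Rightarrow> 'a rel" where
  "left_order_action G \<phi> = (\<lambda>r\<in>left_orders G. pull_order G \<phi> r)"

definition bi_order_action :: "('a, 'b) monoid_scheme \<Rightarrow> ('a \<Rightarrow> 'a) \<Rightarrow> 'a rel \<Rightarrow> 'a rel" where
  "bi_order_action G \<phi> = (\<lambda>r\<in>bi_orders G. pull_order G \<phi> r)"

definition order_conj_classes :: "('a, 'b) monoid_scheme \<Rightarrow> 'a rel set set" where
  "order_conj_classes G =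
    orbits (opposite_group G) (left_orders G) (\<lambda>g. left_order_action G (inner_auto G g))"

definition conj_class_action :: "('a, 'b) monoid_scheme \<Rightarrow> ('a \<Rightarrow> 'a) \<Rightarrow> 'a rel set \<Rightarrow> 'a rel set" where
  "conj_class_action G \<phi> = (\<lambda>C\<in>order_conj_classes G. left_order_action G \<phi> ` C)"

text \<open>
  An action \<open>\<alpha>\<close> of \<open>A\<close> that is trivial on a normal subgroup \<open>N\<close> is constant on each coset of \<open>N\<close>;
  \<open>induced_action \<alpha>\<close> is the resulting action of \<open>A Mod N\<close>.
\<close>

definition induced_action :: "('a \<Rightarrow> 'e \<Rightarrow> 'e) \<Rightarrow> 'a set \<Rightarrow> 'e \<Rightarrow> 'e" where
  "induced_action \<alpha> S = the_elem (\<alpha> ` S)"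

subsection \<open>These are group actions\<close>

lemma group_opposite_group:
  assumes "group A" shows "group (opposite_group A)"
proof -
  interpret group A by fact
  show ?thesis
    by (rule groupI) (auto simp: opposite_group_def m_assoc intro: r_inv)
qed

lemma right_actionI:
  assumes "group A"
    and cl: "\<And>a e. a \<in> carrier A \<Longrightarrow> e \<in> E \<Longrightarrow> act a e \<in> E"
    and one: "\<And>e. e \<in> E \<Longrightarrow> act \<one>\<^bsub>A\<^esub> e = e"
    and mult: "\<And>a b e. a \<in> carrier A \<Longrightarrow> b \<in> carrier A \<Longrightarrow> e \<in> E \<Longrightarrow>
                 act (a \<otimes>\<^bsub>A\<^esub> b) e = act b (act a e)"
  shows "group_action (opposite_group A) E (\<lambda>a. restrict (act a) E)"
proof -
  interpret group A by fact
  have bij: "restrict (act a) E \<in> Bij E" if a: "a \<in> carrier A" for a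
  proof -
    have "bij_betw (act a) E E"
    proof (rule bij_betwI[where g = "act (inv\<^bsub>A\<^esub> a)"])
      show "act (inv\<^bsub>A\<^esub> a) (act a e) = e" if "e \<in> E" for e
        using mult[of a "inv\<^bsub>A\<^esub> a" e] one a that by simp
      show "act a (act (inv\<^bsub>A\<^esub> a) e) = e" if "e \<in> E" for e
        using mult[of "inv\<^bsub>A\<^esub> a" a e] one a that by simp
    qed (use cl a in auto)
    then show ?thesis by (simp add: Bij_def cong: bij_betw_cong)
  qed
  have "(\<lambda>a. restrict (act a) E) \<in> hom (opposite_group A) (BijGroup E)"
    by (rule homI)
      (use bij in \<open>auto simp: BijGroup_def opposite_group_def compose_def cl mult fun_eq_iff\<close>)
  then show ?thesis
    unfolding group_action_def group_hom_def group_hom_axioms_def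
    by (simp add: group_opposite_group group_BijGroup is_group)
qed

lemma induced_group_action:
  assumes act: "group_action (opposite_group A) E \<alpha>" and N: "N \<lhd> A"
    and triv: "\<And>n. n \<in> N \<Longrightarrow> \<alpha> n = (\<lambda>e\<in>E. e)"
  shows "group_action (opposite_group (A Mod N)) E (induced_action \<alpha>)"
proof -
  interpret N: normal N A by fact
  interpret a: group_hom "opposite_group A" "BijGroup E" \<alpha>
    using act by (rule group_action.group_hom)
  have mem: "\<alpha> a \<in> carrier (BijGroup E)" if "a \<in> carrier A" for a
    using that a.hom_closed[of a] by (simp add: opposite_group_def)
  have mult: "\<alpha> (a \<otimes>\<^bsub>A\<^esub> b) = \<alpha> b \<otimes>\<^bsub>BijGroup E\<^esub> \<alpha> a"
    if "a \<in> carrier A" "b \<in> carrier A" for a b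
    using that a.hom_mult[of b a] by (simp add: opposite_group_def)
  have ind: "induced_action \<alpha> (N #>\<^bsub>A\<^esub> a) = \<alpha> a" if a: "a \<in> carrier A" for a
  proof -
    have "\<alpha> (n \<otimes>\<^bsub>A\<^esub> a) = \<alpha> a" if n: "n \<in> N" for n
    proof -
      have "\<alpha> n = \<one>\<^bsub>BijGroup E\<^esub>" using triv[OF n] by (simp add: BijGroup_def)
      then show ?thesis using mult[of n a] a n mem[OF a] by simp
    qed
    moreover have "N #>\<^bsub>A\<^esub> a = (\<lambda>n. n \<otimes>\<^bsub>A\<^esub> a) ` N" by (auto simp: r_coset_def)
    ultimately have "\<alpha> ` (N #>\<^bsub>A\<^esub> a) = (\<lambda>_. \<alpha> a) ` N" by (simp add: image_image)
    also have "\<dots> = {\<alpha> a}" by (rule image_constant[OF subgroup.one_closed[OF N.subgroup_axioms]])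
    finally have "\<alpha> ` (N #>\<^bsub>A\<^esub> a) = {\<alpha> a}" .
    then show ?thesis by (simp add: induced_action_def)
  qed
  have "induced_action \<alpha> \<in> hom (opposite_group (A Mod N)) (BijGroup E)"
  proof (rule homI)
    fix S assume "S \<in> carrier (opposite_group (A Mod N))"
    then obtain a where "a \<in> carrier A" "S = N #>\<^bsub>A\<^esub> a"
      by (auto simp: opposite_group_def carrier_FactGroup)
    then show "induced_action \<alpha> S \<in> carrier (BijGroup E)" by (simp add: ind mem)
  next
    fix S T assume "S \<in> carrier (opposite_group (A Mod N))" "T \<in> carrier (opposite_group (A Mod N))"
    then obtain a b where ab: "a \<in> carrier A" "S = N #>\<^bsub>A\<^esub> a" "b \<in> carrier A" "T = N #>\<^bsub>A\<^esub> b"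
      by (auto simp: opposite_group_def carrier_FactGroup)
    then have "S \<otimes>\<^bsub>opposite_group (A Mod N)\<^esub> T = N #>\<^bsub>A\<^esub> (b \<otimes>\<^bsub>A\<^esub> a)"
      by (simp add: opposite_group_def N.rcos_sum)
    then show "induced_action \<alpha> (S \<otimes>\<^bsub>opposite_group (A Mod N)\<^esub> T) =
        induced_action \<alpha> S \<otimes>\<^bsub>BijGroup E\<^esub> induced_action \<alpha> T"
      using ab by (simp add: ind mult)
  qed
  then show ?thesis
    unfolding group_action_def group_hom_def group_hom_axioms_def
    by (simp add: group_opposite_group group_BijGroup N.factorgroup_is_group)
qed

lemma auto_closed: "\<phi> \<in> auto G \<Longrightarrow> g \<in> carrier G \<Longrightarrow> \<phi> g \<in> carrier G"
  by (auto simp: auto_def hom_def)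

lemma auto_mult:
  "\<phi> \<in> auto G \<Longrightarrow> g \<in> carrier G \<Longrightarrow> h \<in> carrier G \<Longrightarrow> \<phi> (g \<otimes>\<^bsub>G\<^esub> h) = \<phi> g \<otimes>\<^bsub>G\<^esub> \<phi> h"
  by (auto simp: auto_def hom_def)

lemma auto_inj: "\<phi> \<in> auto G \<Longrightarrow> inj_on \<phi> (carrier G)"
  by (auto simp: auto_def Bij_def bij_betw_def)

lemma carrier_AutoGroup: "carrier (AutoGroup G) = auto G"
  by (simp add: AutoGroup_def)

lemma AutoGroup_mult:
  "\<phi> \<in> auto G \<Longrightarrow> \<psi> \<in> auto G \<Longrightarrow> \<phi> \<otimes>\<^bsub>AutoGroup G\<^esub> \<psi> = compose (carrier G) \<phi> \<psi>"
  by (simp add: AutoGroup_def BijGroup_def auto_def)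

lemma AutoGroup_one: "\<one>\<^bsub>AutoGroup G\<^esub> = (\<lambda>x\<in>carrier G. x)"
  by (simp add: AutoGroup_def BijGroup_def)

lemma pull_linear_order:
  assumes "\<phi> \<in> auto G" "linear_order_on (carrier G) r"
  shows "linear_order_on (carrier G) (pull_order G \<phi> r)"
proof -
  note f = auto_closed[OF assms(1)] and i = auto_inj[OF assms(1)]
  have r: "refl_on (carrier G) r" "trans r" "antisym r" "total_on (carrier G) r"
    using assms(2) by (auto simp: order_on_defs)
  have "refl_on (carrier G) (pull_order G \<phi> r)"
    using r(1) f by (auto simp: refl_on_def pull_order_def)
  moreover have "trans (pull_order G \<phi> r)"
    using r(2) unfolding pull_order_def trans_def by blast
  moreover have "antisym (pull_order G \<phi> r)"
    using r(3) i unfolding pull_order_def antisym_def inj_on_def by blast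
  moreover have "total_on (carrier G) (pull_order G \<phi> r)"
    using r(4) i f unfolding pull_order_def total_on_def inj_on_def by blast
  moreover have "pull_order G \<phi> r \<subseteq> carrier G \<times> carrier G" by (auto simp: pull_order_def)
  ultimately show ?thesis by (simp add: order_on_defs)
qed

lemma (in group) pull_left_orders:
  "\<phi> \<in> auto G \<Longrightarrow> r \<in> left_orders G \<Longrightarrow> pull_order G \<phi> r \<in> left_orders G"
  by (auto simp: left_orders_def pull_linear_order) (auto simp: pull_order_def auto_closed auto_mult)

lemma (in group) pull_bi_orders:
  "\<phi> \<in> auto G \<Longrightarrow> r \<in> bi_orders G \<Longrightarrow> pull_order G \<phi> r \<in> bi_orders G"
  by (auto simp: bi_orders_def pull_left_orders) (auto simp: pull_order_def auto_closed auto_mult)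

lemma bi_orders_left: "r \<in> bi_orders G \<Longrightarrow> r \<in> left_orders G"
  by (simp add: bi_orders_def)

lemma left_orders_subset: "r \<in> left_orders G \<Longrightarrow> r \<subseteq> carrier G \<times> carrier G"
  by (simp add: left_orders_def order_on_defs)

lemma pull_order_one: "r \<in> left_orders G \<Longrightarrow> pull_order G \<one>\<^bsub>AutoGroup G\<^esub> r = r"
  using left_orders_subset[of r G] by (auto simp: pull_order_def AutoGroup_one)

lemma pull_order_mult:
  "\<phi> \<in> auto G \<Longrightarrow> \<psi> \<in> auto G \<Longrightarrow>
    pull_order G (\<phi> \<otimes>\<^bsub>AutoGroup G\<^esub> \<psi>) r = pull_order G \<psi> (pull_order G \<phi> r)"
  by (auto simp: pull_order_def AutoGroup_mult compose_def auto_closed)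

theorem (in group) left_order_action:
  "group_action (opposite_group (AutoGroup G)) (left_orders G) (left_order_action G)"
  unfolding left_order_action_def
  by (rule right_actionI[OF AutoGroup])
    (auto simp: carrier_AutoGroup pull_left_orders pull_order_one pull_order_mult)

theorem (in group) bi_order_action:
  "group_action (opposite_group (AutoGroup G)) (bi_orders G) (bi_order_action G)"
  unfolding bi_order_action_def
  by (rule right_actionI[OF AutoGroup])
    (auto simp: carrier_AutoGroup pull_bi_orders pull_order_one pull_order_mult bi_orders_left)

lemma (in group) inner_auto_hom: "inner_auto G \<in> hom G (AutoGroup G)"
proof -
  have cl: "inner_auto G g \<in> auto G" if g: "g \<in> carrier G" for g
  proof -
    have c: "inv a \<otimes> (a \<otimes> h \<otimes> inv a) \<otimes> inv (inv a) = h"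
      if "a \<in> carrier G" "h \<in> carrier G" for a h
    proof -
      have "inv a \<otimes> (a \<otimes> h \<otimes> inv a) \<otimes> a = (inv a \<otimes> a) \<otimes> h \<otimes> (inv a \<otimes> a)"
        using that by (simp only: m_assoc inv_closed m_closed)
      then show ?thesis using that by simp
    qed
    have "bij_betw (inner_auto G g) (carrier G) (carrier G)"
      by (rule bij_betwI[where g = "inner_auto G (inv g)"])
        (use g c[of g] c[of "inv g"] in \<open>auto simp: inner_auto_def\<close>)
    moreover have "inner_auto G g \<in> hom G G"
    proof (rule homI)
      fix x y assume xy: "x \<in> carrier G" "y \<in> carrier G"
      have "g \<otimes> (x \<otimes> y) \<otimes> inv g = g \<otimes> x \<otimes> (inv g \<otimes> g) \<otimes> y \<otimes> inv g"
        using g xy by (simp add: m_assoc)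
      also have "\<dots> = g \<otimes> x \<otimes> inv g \<otimes> (g \<otimes> y \<otimes> inv g)"
        using g xy by (simp only: m_assoc inv_closed m_closed)
      finally show "inner_auto G g (x \<otimes> y) = inner_auto G g x \<otimes> inner_auto G g y"
        using g xy by (simp add: inner_auto_def)
    qed (use g in \<open>auto simp: inner_auto_def\<close>)
    ultimately show ?thesis by (simp add: auto_def Bij_def inner_auto_def)
  qed
  show ?thesis
  proof (rule homI)
    fix g h assume gh: "g \<in> carrier G" "h \<in> carrier G"
    show "inner_auto G (g \<otimes> h) = inner_auto G g \<otimes>\<^bsub>AutoGroup G\<^esub> inner_auto G h"
      unfolding AutoGroup_mult[OF cl[OF gh(1)] cl[OF gh(2)]]
      using gh by (auto simp: inner_auto_def compose_def fun_eq_iff m_assoc inv_mult_group)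
  qed (simp add: carrier_AutoGroup cl)
qed

lemma (in group) inner_auto_closed: "g \<in> carrier G \<Longrightarrow> inner_auto G g \<in> auto G"
  using inner_auto_hom by (auto simp: hom_def carrier_AutoGroup)

lemma (in group) auto_inner_auto:
  assumes "\<phi> \<in> auto G" "g \<in> carrier G"
  shows "\<phi> \<otimes>\<^bsub>AutoGroup G\<^esub> inner_auto G g = inner_auto G (\<phi> g) \<otimes>\<^bsub>AutoGroup G\<^esub> \<phi>"
proof -
  have "group_hom G G \<phi>"
    using assms(1) by (intro group_hom.intro group_hom_axioms.intro is_group) (simp add: auto_def)
  then have "\<phi> (inv g) = inv (\<phi> g)" using assms(2) by (rule group_hom.hom_inv)
  then show ?thesis
    unfolding AutoGroup_mult[OF assms(1) inner_auto_closed[OF assms(2)]]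
      AutoGroup_mult[OF inner_auto_closed[OF auto_closed[OF assms]] assms(1)]
    using assms by (auto simp: auto_closed auto_mult inner_auto_def[of G] compose_def fun_eq_iff)
qed

theorem (in group) inner_auto_normal: "inner_auto G ` carrier G \<lhd> AutoGroup G"
proof -
  interpret A: group "AutoGroup G" by (rule AutoGroup)
  interpret i: group_hom G "AutoGroup G" "inner_auto G"
    by (intro group_hom.intro group_hom_axioms.intro is_group AutoGroup inner_auto_hom)
  show ?thesis
  proof (rule A.normal_invI)
    show "subgroup (inner_auto G ` carrier G) (AutoGroup G)" by (rule i.img_is_subgroup)
  next
    fix \<phi> \<psi> assume \<phi>: "\<phi> \<in> carrier (AutoGroup G)" and "\<psi> \<in> inner_auto G ` carrier G"
    then obtain g where g: "g \<in> carrier G" "\<psi> = inner_auto G g" by auto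
    have \<phi>': "\<phi> \<in> auto G" using \<phi> by (simp add: carrier_AutoGroup)
    have "\<phi> g \<in> carrier G" using \<phi>' g by (simp add: auto_closed)
    then have "inner_auto G (\<phi> g) \<in> carrier (AutoGroup G)" by simp
    then have "\<phi> \<otimes>\<^bsub>AutoGroup G\<^esub> \<psi> \<otimes>\<^bsub>AutoGroup G\<^esub> inv\<^bsub>AutoGroup G\<^esub> \<phi> = inner_auto G (\<phi> g)"
      using auto_inner_auto[OF \<phi>' g(1)] g(2) \<phi> by (simp add: A.m_assoc)
    then show "\<phi> \<otimes>\<^bsub>AutoGroup G\<^esub> \<psi> \<otimes>\<^bsub>AutoGroup G\<^esub> inv\<^bsub>AutoGroup G\<^esub> \<phi> \<in> inner_auto G ` carrier G"
      using \<open>\<phi> g \<in> carrier G\<close> by simp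
  qed
qed

lemma (in group) bi_orders_iff:
  assumes r: "r \<in> bi_orders G" and "a \<in> carrier G" "b \<in> carrier G" "g \<in> carrier G"
  shows "(g \<otimes> a \<otimes> inv g, g \<otimes> b \<otimes> inv g) \<in> r \<longleftrightarrow> (a, b) \<in> r"
proof -
  have *: "(g \<otimes> a \<otimes> inv g, g \<otimes> b \<otimes> inv g) \<in> r"
    if "(a, b) \<in> r" "a \<in> carrier G" "b \<in> carrier G" "g \<in> carrier G" for a b g
    using that r by (auto simp: bi_orders_def left_orders_def)
  have "inv g \<otimes> (g \<otimes> x \<otimes> inv g) \<otimes> inv (inv g) = x" if "x \<in> carrier G" for x
  proof -
    have "inv g \<otimes> (g \<otimes> x \<otimes> inv g) \<otimes> g = (inv g \<otimes> g) \<otimes> x \<otimes> (inv g \<otimes> g)"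
      using that assms(4) by (simp only: m_assoc inv_closed m_closed)
    then show ?thesis using that assms(4) by simp
  qed
  then show ?thesis
    using *[of a b g] *[of "g \<otimes> a \<otimes> inv g" "g \<otimes> b \<otimes> inv g" "inv g"] assms(2-4) by auto
qed

theorem (in group) out_bi_order_action:
  "group_action (opposite_group (OutGroup G)) (bi_orders G) (induced_action (bi_order_action G))"
  unfolding OutGroup_def
proof (rule induced_group_action[OF bi_order_action inner_auto_normal])
  fix \<phi> assume "\<phi> \<in> inner_auto G ` carrier G"
  then obtain g where g: "g \<in> carrier G" "\<phi> = inner_auto G g" by auto
  have "pull_order G \<phi> r = r" if r: "r \<in> bi_orders G" for r
  proof -
    have "r \<subseteq> carrier G \<times> carrier G"
      using r by (intro left_orders_subset bi_orders_left)
    then show ?thesis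
      using bi_orders_iff[OF r _ _ g(1)] g(2) by (auto simp: pull_order_def inner_auto_def)
  qed
  then show "bi_order_action G \<phi> = (\<lambda>r\<in>bi_orders G. r)"
    by (auto simp: bi_order_action_def fun_eq_iff)
qed

theorem (in group) conjugation_left_order_action:
  "group_action (opposite_group G) (left_orders G) (\<lambda>g. left_order_action G (inner_auto G g))"
proof -
  interpret a: group_hom "opposite_group (AutoGroup G)" "BijGroup (left_orders G)" "left_order_action G"
    using left_order_action by (rule group_action.group_hom)
  have "inner_auto G \<in> hom (opposite_group G) (opposite_group (AutoGroup G))"
    using inner_auto_hom by (auto simp: hom_def opposite_group_def)
  then have "(left_order_action G \<circ> inner_auto G) \<in> hom (opposite_group G) (BijGroup (left_orders G))"
    using a.homh by (rule Group.hom_compose)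
  then show ?thesis
    unfolding group_action_def group_hom_def group_hom_axioms_def
    by (auto simp: group_opposite_group is_group group_BijGroup comp_def)
qed

definition order_conj_class :: "('a, 'b) monoid_scheme \<Rightarrow> 'a rel \<Rightarrow> 'a rel set" where
  "order_conj_class G r = (\<lambda>g. pull_order G (inner_auto G g) r) ` carrier G"

lemma order_conj_classes_eq: "order_conj_classes G = order_conj_class G ` left_orders G"
  by (fastforce simp: order_conj_classes_def orbits_def orbit_def opposite_group_def
      left_order_action_def order_conj_class_def image_def)

lemma (in group) order_conj_class_subset:
  "r \<in> left_orders G \<Longrightarrow> order_conj_class G r \<subseteq> left_orders G"
  by (auto simp: order_conj_class_def inner_auto_closed pull_left_orders)

lemma (in group) pull_order_conj_class:
  assumes \<phi>: "\<phi> \<in> auto G"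
  shows "pull_order G \<phi> ` order_conj_class G r = order_conj_class G (pull_order G \<phi> r)"
proof -
  have *: "pull_order G \<phi> (pull_order G (inner_auto G (\<phi> h)) r) =
      pull_order G (inner_auto G h) (pull_order G \<phi> r)" if "h \<in> carrier G" for h
    using that \<phi> auto_inner_auto[OF \<phi> that]
    by (simp add: inner_auto_closed auto_closed flip: pull_order_mult)
  have "\<phi> ` carrier G = carrier G" using \<phi> by (simp add: auto_def Bij_def bij_betw_def)
  then have "order_conj_class G r = (\<lambda>g. pull_order G (inner_auto G g) r) ` \<phi> ` carrier G"
    by (simp add: order_conj_class_def)
  then show ?thesis
    by (simp add: image_image * order_conj_class_def[of G "pull_order G \<phi> r"] cong: image_cong)
qed

lemma (in group) order_conj_class_inner:
  assumes g: "g \<in> carrier G"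
  shows "order_conj_class G (pull_order G (inner_auto G g) r) = order_conj_class G r"
proof -
  have "pull_order G (inner_auto G h) (pull_order G (inner_auto G g) r) =
      pull_order G (inner_auto G (g \<otimes> h)) r" if "h \<in> carrier G" for h
    using that g hom_mult[OF inner_auto_hom g that]
    by (simp add: inner_auto_closed pull_order_mult)
  then have "order_conj_class G (pull_order G (inner_auto G g) r) =
      (\<lambda>h. pull_order G (inner_auto G (g \<otimes> h)) r) ` carrier G"
    by (simp add: order_conj_class_def cong: image_cong)
  also have "\<dots> = (\<lambda>h. pull_order G (inner_auto G h) r) ` ((\<lambda>h. g \<otimes> h) ` carrier G)"
    by (simp add: image_image)
  also have "(\<lambda>h. g \<otimes> h) ` carrier G = carrier G" using g by (rule surj_const_mult)
  finally show ?thesis by (simp add: order_conj_class_def)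
qed

lemma (in group) conj_class_action_eq:
  "conj_class_action G \<phi> = (\<lambda>C\<in>order_conj_classes G. pull_order G \<phi> ` C)"
proof -
  have "left_order_action G \<phi> ` C = pull_order G \<phi> ` C" if "C \<in> order_conj_classes G" for C
  proof (rule image_cong)
    fix r assume "r \<in> C"
    then have "r \<in> left_orders G"
      using that order_conj_class_subset by (auto simp: order_conj_classes_eq)
    then show "left_order_action G \<phi> r = pull_order G \<phi> r" by (simp add: left_order_action_def)
  qed simp
  then show ?thesis by (auto simp: conj_class_action_def fun_eq_iff)
qed

theorem (in group) conj_class_action:
  "group_action (opposite_group (AutoGroup G)) (order_conj_classes G) (conj_class_action G)"
  unfolding conj_class_action_eq
proof (rule right_actionI[OF AutoGroup])
  fix C assume "C \<in> order_conj_classes G"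
  then obtain r where r: "r \<in> left_orders G" "C = order_conj_class G r"
    by (auto simp: order_conj_classes_eq)
  show "pull_order G \<phi> ` C \<in> order_conj_classes G" if "\<phi> \<in> carrier (AutoGroup G)" for \<phi>
    using that r
    by (auto simp: carrier_AutoGroup order_conj_classes_eq pull_order_conj_class pull_left_orders)
  have "pull_order G \<one>\<^bsub>AutoGroup G\<^esub> s = s" if "s \<in> C" for s
    using subsetD[OF order_conj_class_subset[OF r(1)]] that r(2)
    by (simp add: pull_order_one)
  then show "pull_order G \<one>\<^bsub>AutoGroup G\<^esub> ` C = C" by simp
qed (auto simp: carrier_AutoGroup pull_order_mult image_image)

theorem (in group) out_conj_class_action:
  "group_action (opposite_group (OutGroup G)) (order_conj_classes G)
     (induced_action (conj_class_action G))"
  unfolding OutGroup_def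
proof (rule induced_group_action[OF conj_class_action inner_auto_normal])
  fix \<phi> assume "\<phi> \<in> inner_auto G ` carrier G"
  then obtain g where g: "g \<in> carrier G" "\<phi> = inner_auto G g" by auto
  have "pull_order G \<phi> ` C = C" if C: "C \<in> order_conj_classes G" for C
  proof -
    obtain r where "C = order_conj_class G r"
      using C unfolding order_conj_classes_eq by blast
    then show ?thesis
      using g by (simp add: pull_order_conj_class inner_auto_closed order_conj_class_inner)
  qed
  then show "conj_class_action G \<phi> = (\<lambda>C\<in>order_conj_classes G. C)"
    unfolding conj_class_action_eq by (intro restrict_ext) simp
qed

end

theory Submission
  imports Defs
begin

text \<open>
  Multiplying every element of odd exponent in \<open>x\<close> by \<open>y\<close> on the right is an automorphism
  \<open>\<phi>\<close> of \<open>K\<close>, namely the one sending \<open>x\<close> to \<open>xy\<close> and fixing \<open>y\<close>. Elements of odd exponent in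
  \<open>x\<close> conjugate \<open>y\<close> to its inverse, so \<open>(gy)\<^sup>2 = g\<^sup>2\<close> for them, and thus \<open>\<phi> g\<close> and \<open>g\<close>
  always have the same square. In a left-ordered group an element has the same sign as its square;
  hence \<open>\<phi>\<close> fixes every left-invariant ordering. It is not inner, because \<open>xy\<close> and \<open>x\<close> have
  exponents in \<open>y\<close> of different parity.
\<close>

section \<open>Signs of squares in left-ordered groups\<close>

text \<open>Suppose \<open>u\<close> and \<open>v\<close> have the same square, 1 \<le> u and v < 1.
  Left multiplication gives 1 \<le> u \<le> uu = vv \<le> v, a contradiction.\<close>

lemma (in group) left_orders_square_iff:
  assumes r: "r \<in> left_orders G" and c: "c \<in> carrier G" "d \<in> carrier G"
    and sq: "c \<otimes> c = d \<otimes> d"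
  shows "(\<one>, c) \<in> r \<longleftrightarrow> (\<one>, d) \<in> r"
proof -
  have tr: "trans r" and an: "antisym r" and tot: "total_on (carrier G) r"
    and re: "refl_on (carrier G) r"
    using r by (auto simp: left_orders_def order_on_defs)
  have inv: "(z \<otimes> a, z \<otimes> b) \<in> r"
    if "(a, b) \<in> r" "a \<in> carrier G" "b \<in> carrier G" "z \<in> carrier G" for a b z
    using that r by (auto simp: left_orders_def)
  have *: "(\<one>, v) \<in> r"
    if uv: "u \<in> carrier G" "v \<in> carrier G" "u \<otimes> u = v \<otimes> v" "(\<one>, u) \<in> r" for u v
  proof (rule ccontr)
    assume n: "(\<one>, v) \<notin> r"
    then have "v \<noteq> \<one>" using re by (auto simp: refl_on_def)
    then have vr: "(v, \<one>) \<in> r" using n tot uv(2) by (auto simp: total_on_def)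
    have "(v \<otimes> v, v) \<in> r" using inv[OF vr _ _ uv(2)] uv(2) by simp
    moreover have "(\<one>, v \<otimes> v) \<in> r"
      using inv[OF uv(4) _ _ uv(1)] uv tr by (auto elim: transE)
    ultimately show False using n tr by (blast elim: transE)
  qed
  show ?thesis using *[of c d] *[of d c] c sq by auto
qed

text \<open>A left-invariant ordering is determined by its positive cone: a \<le> b iff a^-1 b is at
  least 1. Since \<phi> keeps the square of a^-1 b, it also keeps its sign.\<close>

lemma (in group) pull_order_square_preserving:
  assumes \<phi>: "\<phi> \<in> auto G" and sq: "\<And>g. g \<in> carrier G \<Longrightarrow> \<phi> g \<otimes> \<phi> g = g \<otimes> g"
    and r: "r \<in> left_orders G"
  shows "pull_order G \<phi> r = r"
proof -
  have inv: "(z \<otimes> a, z \<otimes> b) \<in> r"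
    if "(a, b) \<in> r" "a \<in> carrier G" "b \<in> carrier G" "z \<in> carrier G" for a b z
    using that r by (auto simp: left_orders_def)
  have iff: "(a, b) \<in> r \<longleftrightarrow> (\<one>, inv a \<otimes> b) \<in> r" if "a \<in> carrier G" "b \<in> carrier G" for a b
    using inv[of a b "inv a"] inv[of \<one> "inv a \<otimes> b" a] that by (auto simp flip: m_assoc)
  have "group_hom G G \<phi>"
    using \<phi> by (intro group_hom.intro group_hom_axioms.intro is_group) (simp add: auto_def)
  note hinv = group_hom.hom_inv[OF this]
  have "(\<phi> a, \<phi> b) \<in> r \<longleftrightarrow> (a, b) \<in> r" if ab: "a \<in> carrier G" "b \<in> carrier G" for a b
  proof -
    have c: "inv a \<otimes> b \<in> carrier G" using ab by simp
    have "(\<phi> a, \<phi> b) \<in> r \<longleftrightarrow> (\<one>, \<phi> (inv a \<otimes> b)) \<in> r"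
      unfolding iff[OF auto_closed[OF \<phi> ab(1)] auto_closed[OF \<phi> ab(2)]]
      using ab \<phi> by (simp add: auto_mult hinv)
    also have "\<dots> \<longleftrightarrow> (\<one>, inv a \<otimes> b) \<in> r"
      by (rule left_orders_square_iff[OF r auto_closed[OF \<phi> c] c sq[OF c]])
    finally show ?thesis unfolding iff[OF ab] .
  qed
  then show ?thesis
    using left_orders_subset[OF r] by (auto simp: pull_order_def)
qed

section \<open>From a trivially acting outer automorphism to non-faithful actions\<close>

lemma not_faithfulI:
  assumes "a \<in> carrier A" "b \<in> carrier A" "a \<noteq> b" "\<alpha> a = \<alpha> b"
  shows "\<not> faithful_action A E \<alpha>"
  using assms by (auto simp: faithful_action_def faithful_action_axioms_def inj_on_def)

text \<open>The coset of \<phi> differs from \<open>N\<close>, yet \<alpha> has the same image on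
  both, and \<open>induced_action\<close> depends only on that image.\<close>

lemma induced_action_not_faithful:
  assumes act: "group_action (opposite_group A) E \<alpha>" and N: "N \<lhd> A"
    and \<phi>: "\<phi> \<in> carrier A" "\<phi> \<notin> N" and triv: "\<alpha> \<phi> = (\<lambda>e\<in>E. e)"
  shows "\<not> faithful_action (opposite_group (A Mod N)) E (induced_action \<alpha>)"
proof (rule not_faithfulI)
  interpret N: normal N A by fact
  interpret a: group_hom "opposite_group A" "BijGroup E" \<alpha>
    using act by (rule group_action.group_hom)
  show "N #>\<^bsub>A\<^esub> \<phi> \<in> carrier (opposite_group (A Mod N))"
    using \<phi> by (auto simp: opposite_group_def carrier_FactGroup)
  show "N \<in> carrier (opposite_group (A Mod N))"
    using group.is_monoid[OF N.factorgroup_is_group, THEN monoid.one_closed]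
    by (simp add: opposite_group_def)
  show "N #>\<^bsub>A\<^esub> \<phi> \<noteq> N"
    using N.rcos_self[OF \<phi>(1) N.subgroup_axioms] \<phi>(2) by auto
  have "\<alpha> (n \<otimes>\<^bsub>A\<^esub> \<phi>) = \<alpha> n" if n: "n \<in> N" for n
  proof -
    have nA: "n \<in> carrier A" using n by simp
    have "\<alpha> n \<in> carrier (BijGroup E)" using a.hom_closed[of n] nA by (simp add: opposite_group_def)
    moreover have "\<alpha> \<phi> = \<one>\<^bsub>BijGroup E\<^esub>" using triv by (simp add: BijGroup_def)
    ultimately show ?thesis
      \<comment> \<open>In the opposite group the product of \<phi> and \<open>n\<close>, in this
        order, is n\<phi>.\<close>
      using a.hom_mult[of \<phi> n] \<phi>(1) nA by (simp add: opposite_group_def)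
  qed
  moreover have "N #>\<^bsub>A\<^esub> \<phi> = (\<lambda>n. n \<otimes>\<^bsub>A\<^esub> \<phi>) ` N" by (auto simp: r_coset_def)
  ultimately show "induced_action \<alpha> (N #>\<^bsub>A\<^esub> \<phi>) = induced_action \<alpha> N"
    by (simp add: induced_action_def image_image)
qed

text \<open>Bi-invariant orderings are left-invariant and conjugacy classes consist of
  left-invariant orderings, so one automorphism serves all three actions. Being outer, it is
  nontrivial in Aut(G) and in Out(G).\<close>

lemma (in group) order_actions_not_faithful:
  assumes \<phi>: "\<phi> \<in> auto G" and outer: "\<phi> \<notin> inner_auto G ` carrier G"
    and triv: "\<And>r. r \<in> left_orders G \<Longrightarrow> pull_order G \<phi> r = r"
  shows "\<not> faithful_action (opposite_group (AutoGroup G)) (left_orders G) (left_order_action G)"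
    and "\<not> faithful_action (opposite_group (OutGroup G)) (bi_orders G)
           (induced_action (bi_order_action G))"
    and "\<not> faithful_action (opposite_group (OutGroup G)) (order_conj_classes G)
           (induced_action (conj_class_action G))"
proof -
  interpret A: group "AutoGroup G" by (rule AutoGroup)
  have \<phi>A: "\<phi> \<in> carrier (AutoGroup G)" using \<phi> by (simp add: carrier_AutoGroup)
  show "\<not> faithful_action (opposite_group (AutoGroup G)) (left_orders G) (left_order_action G)"
  proof (rule not_faithfulI)
    show "\<phi> \<in> carrier (opposite_group (AutoGroup G))"
      "\<one>\<^bsub>AutoGroup G\<^esub> \<in> carrier (opposite_group (AutoGroup G))"
      using \<phi>A by (simp_all add: opposite_group_def)
    have "\<one>\<^bsub>AutoGroup G\<^esub> \<in> inner_auto G ` carrier G"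
      using inner_auto_normal by (simp add: normal_def subgroup.one_closed)
    then show "\<phi> \<noteq> \<one>\<^bsub>AutoGroup G\<^esub>" using outer by auto
    show "left_order_action G \<phi> = left_order_action G \<one>\<^bsub>AutoGroup G\<^esub>"
      by (auto simp: left_order_action_def fun_eq_iff triv pull_order_one)
  qed
  show "\<not> faithful_action (opposite_group (OutGroup G)) (bi_orders G)
      (induced_action (bi_order_action G))"
    unfolding OutGroup_def
    by (rule induced_action_not_faithful[OF bi_order_action inner_auto_normal \<phi>A outer])
      (auto simp: bi_order_action_def fun_eq_iff triv bi_orders_left)
  have "pull_order G \<phi> ` C = C" if "C \<in> order_conj_classes G" for C
  proof -
    have "C \<subseteq> left_orders G"
      using that order_conj_class_subset by (auto simp: order_conj_classes_eq)
    then show ?thesis using triv by (force simp: image_def)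
  qed
  then have "conj_class_action G \<phi> = (\<lambda>C\<in>order_conj_classes G. C)"
    unfolding conj_class_action_eq by (intro restrict_ext) simp
  then show "\<not> faithful_action (opposite_group (OutGroup G)) (order_conj_classes G)
      (induced_action (conj_class_action G))"
    unfolding OutGroup_def
    by (rule induced_action_not_faithful[OF conj_class_action inner_auto_normal \<phi>A outer])
qed

section \<open>Twisting the odd elements by a fixed element\<close>

text \<open>\<open>P\<close> plays the part of a homomorphism to Z/2 with \<open>y\<close> in its
  kernel. In a product with first factor gy, the \<open>y\<close> moves past an even
  \<open>h\<close>, while an odd \<open>h\<close> gives gyhy = gh. The case h = g of the latter
  yields the claim on squares.\<close>

lemma (in group) parity_twist:
  fixes P :: "'a \<Rightarrow> bool"
  assumes y: "y \<in> carrier G" "\<not> P y"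
    and P: "\<And>g h. g \<in> carrier G \<Longrightarrow> h \<in> carrier G \<Longrightarrow> P (g \<otimes> h) \<longleftrightarrow> P g \<noteq> P h"
    and even: "\<And>g. g \<in> carrier G \<Longrightarrow> \<not> P g \<Longrightarrow> y \<otimes> g = g \<otimes> y"
    and odd: "\<And>g. g \<in> carrier G \<Longrightarrow> P g \<Longrightarrow> y \<otimes> g \<otimes> y = g"
  defines "\<phi> \<equiv> \<lambda>g\<in>carrier G. if P g then g \<otimes> y else g"
  shows "\<phi> \<in> auto G" and "\<And>g. g \<in> carrier G \<Longrightarrow> \<phi> g \<otimes> \<phi> g = g \<otimes> g"
proof -
  have "\<not> P \<one>" using P[of \<one> \<one>] by simp
  then have Pinv: "\<not> P (inv y)" using P[of y "inv y"] y by simp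
  have "bij_betw \<phi> (carrier G) (carrier G)"
    \<comment> \<open>Since \<open>y\<close> and its inverse are even, neither map changes the
      parity, so they undo each other.\<close>
    by (rule bij_betwI[where g = "\<lambda>g. if P g then g \<otimes> inv y else g"])
      (use y Pinv P in \<open>auto simp: \<phi>_def m_assoc\<close>)
  moreover have "\<phi> \<in> hom G G"
  proof (rule homI)
    fix g h assume gh: "g \<in> carrier G" "h \<in> carrier G"
    have "g \<otimes> (y \<otimes> h) = g \<otimes> (h \<otimes> y)" if "\<not> P h"
      using even[OF gh(2) that] by simp
    moreover have "g \<otimes> (y \<otimes> (h \<otimes> y)) = g \<otimes> h" if "P h"
      using odd[OF gh(2) that] gh y by (simp add: m_assoc)
    ultimately show "\<phi> (g \<otimes> h) = \<phi> g \<otimes> \<phi> h"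
      using gh y P[OF gh] by (auto simp: \<phi>_def m_assoc)
  qed (use y in \<open>auto simp: \<phi>_def\<close>)
  ultimately show "\<phi> \<in> auto G" by (simp add: auto_def Bij_def \<phi>_def)
  show "\<phi> g \<otimes> \<phi> g = g \<otimes> g" if g: "g \<in> carrier G" for g
    using odd[OF g] g y by (auto simp: \<phi>_def m_assoc)
qed

section \<open>Exponent parities in the Klein bottle group\<close>

text \<open>This is the exponent sum of \<open>a\<close> modulo 2. As 1 and -1 agree modulo 2, the
  signs of the letters can be ignored.\<close>

definition odd_count :: "'a \<Rightarrow> 'a word \<Rightarrow> bool" where
  "odd_count a w \<longleftrightarrow> odd (count_list (map fst w) a)"

lemma odd_count_append: "odd_count a (u @ v) \<longleftrightarrow> odd_count a u \<noteq> odd_count a v"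
  by (simp add: odd_count_def)

lemma word_eq_odd_count:
  assumes "word_eq R u v" and "\<And>l r. (l, r) \<in> R \<Longrightarrow> odd_count a l = odd_count a r"
  shows "odd_count a u = odd_count a v"
  using assms(1)
proof induction
  case (cancel u b s v)
  show ?case unfolding odd_count_append by (auto simp: odd_count_def)
qed (auto simp: odd_count_append assms(2))

text \<open>The existential merely selects a representative: in a class of the Klein bottle group
  all words have the same parity.\<close>

definition odd_class :: "'a \<Rightarrow> 'a word set \<Rightarrow> bool" where
  "odd_class a A \<longleftrightarrow> (\<exists>w\<in>A. odd_count a w)"

abbreviation klein_rels :: "(klein_gen word \<times> klein_gen word) set" where
  "klein_rels \<equiv> {([(X, False), (Y, True), (X, True)], [(Y, False)])}"

abbreviation klein_class :: "klein_gen word \<Rightarrow> klein_gen word set" where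
  "klein_class w \<equiv> word_rel klein_rels `` {w}"

lemma klein_carrier: "carrier klein_bottle_group = range klein_class"
  by (auto simp: klein_bottle_group_def presented_group_def quotient_def)

lemma klein_mult:
  "klein_class u \<otimes>\<^bsub>klein_bottle_group\<^esub> klein_class v = klein_class (u @ v)"
  by (simp add: klein_bottle_group_def presented_group_mult)

text \<open>The defining relation has two letters \<open>X\<close> on the left and none on the
  right, and one letter \<open>Y\<close> on each side.\<close>

lemma odd_class_klein: "odd_class a (klein_class w) \<longleftrightarrow> odd_count a w"
proof -
  have "odd_count a u = odd_count a w" if "word_eq klein_rels w u" for u
    using word_eq_odd_count[OF that, of a] by (cases a) (auto simp: odd_count_def)
  then show ?thesis
    by (auto simp: odd_class_def word_rel_def intro: word_eq.refl)
qed

lemma odd_class_mult: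
  assumes "g \<in> carrier klein_bottle_group" "h \<in> carrier klein_bottle_group"
  shows "odd_class a (g \<otimes>\<^bsub>klein_bottle_group\<^esub> h) \<longleftrightarrow> odd_class a g \<noteq> odd_class a h"
  using assms by (auto simp: klein_carrier klein_mult odd_class_klein odd_count_append)

section \<open>Moving y through a word\<close>

text \<open>The relation gives yx = xy^-1. Multiplying by y^-1 on the left and y on the right gives
  the case of y^-1, and multiplying by x^-1 on both sides gives the cases of x^-1.\<close>

lemma klein_swap_X: "word_eq klein_rels [(Y, b), (X, s)] [(X, s), (Y, \<not> b)]"
proof -
  note [trans] = word_eq.trans
  have YX: "word_eq klein_rels [(Y, True), (X, True)] [(X, True), (Y, False)]"
  proof -
    have "word_eq klein_rels [(Y, True), (X, True)]
        [(X, True), (X, False), (Y, True), (X, True)]"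
      using word_eq.sym[OF word_eq.cancel[of _ "[]" X True "[(Y, True), (X, True)]"]] by simp
    also have "word_eq klein_rels [(X, True), (X, False), (Y, True), (X, True)]
        [(X, True), (Y, False)]"
      using word_eq.relation[of "[(X, False), (Y, True), (X, True)]" "[(Y, False)]" klein_rels
          "[(X, True)]" "[]"] by simp
    finally show ?thesis .
  qed
  have Y'X: "word_eq klein_rels [(Y, False), (X, True)] [(X, True), (Y, True)]"
  proof -
    have "word_eq klein_rels [(Y, False), (X, True)]
        [(Y, False), (X, True), (Y, False), (Y, True)]"
      using word_eq.sym[OF word_eq.cancel[of _ "[(Y, False), (X, True)]" Y False "[]"]] by simp
    also have "word_eq klein_rels [(Y, False), (X, True), (Y, False), (Y, True)]
        [(Y, False), (Y, True), (X, True), (Y, True)]"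
      using word_eq_context[OF word_eq.sym[OF YX], of "[(Y, False)]" "[(Y, True)]"] by simp
    also have "word_eq klein_rels [(Y, False), (Y, True), (X, True), (Y, True)]
        [(X, True), (Y, True)]"
      using word_eq.cancel[of _ "[]" Y False] by simp
    finally show ?thesis .
  qed
  have X: "word_eq klein_rels [(Y, b), (X, True)] [(X, True), (Y, \<not> b)]" for b
    using YX Y'X by (cases b) simp_all
  have "word_eq klein_rels [(Y, b), (X, False)] [(X, False), (X, True), (Y, b), (X, False)]"
    using word_eq.sym[OF word_eq.cancel[of _ "[]" X False "[(Y, b), (X, False)]"]] by simp
  also have "word_eq klein_rels [(X, False), (X, True), (Y, b), (X, False)]
      [(X, False), (Y, \<not> b), (X, True), (X, False)]"
    using word_eq_context[OF word_eq.sym[OF X[of "\<not> b"]], of "[(X, False)]" "[(X, False)]"] by simp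
  also have "word_eq klein_rels [(X, False), (Y, \<not> b), (X, True), (X, False)]
      [(X, False), (Y, \<not> b)]"
    using word_eq.cancel[of _ "[(X, False), (Y, \<not> b)]" X True "[]"] by simp
  finally show ?thesis using X[of b] by (cases s) simp_all
qed

lemma klein_swap_Y: "word_eq R [(Y, b), (Y, s)] [(Y, s), (Y, b)]"
proof (cases "s = b")
  case False
  then have "word_eq R [(Y, b), (Y, s)] []" "word_eq R [(Y, s), (Y, b)] []"
    using word_eq.cancel[of R "[]" Y b "[]"] word_eq.cancel[of R "[]" Y s "[]"]
    by (cases s; cases b; simp)+
  then show ?thesis by (blast intro: word_eq.intros)
qed (simp add: word_eq.refl)

text \<open>Each letter \<open>X\<close>, of either sign, inverts the passing y and each letter
  \<open>Y\<close> leaves it alone. On booleans \<noteq> is exclusive or, which records the flips.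
  Both commutation hypotheses of \<open>parity_twist\<close> come from this.\<close>

lemma klein_move_Y: "word_eq klein_rels ((Y, b) # w) (w @ [(Y, b \<noteq> odd_count X w)])"
proof (induction w arbitrary: b)
  case Nil
  show ?case by (simp add: odd_count_def word_eq.refl)
next
  case (Cons l w)
  obtain a s where l: "l = (a, s)" by (cases l)
  have "word_eq klein_rels [(Y, b), l] [l, (Y, b \<noteq> (a = X))]"
    using klein_swap_X[of b s] klein_swap_Y[of _ b s] by (cases a) (simp_all add: l)
  then have "word_eq klein_rels ((Y, b) # l # w) (l # (Y, b \<noteq> (a = X)) # w)"
    using word_eq_context[of _ _ _ "[]" w] by fastforce
  moreover have "word_eq klein_rels (l # (Y, b \<noteq> (a = X)) # w)
      (l # w @ [(Y, (b \<noteq> (a = X)) \<noteq> odd_count X w)])"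
    using word_eq_context[OF Cons.IH[of "b \<noteq> (a = X)"], of "[l]" "[]"] by simp
  moreover have "((b \<noteq> (a = X)) \<noteq> odd_count X w) \<longleftrightarrow> (b \<noteq> odd_count X (l # w))"
    by (auto simp: odd_count_def l)
  ultimately show ?case by (auto intro: word_eq.trans)
qed

theorem proposition1p3:
  shows "\<not> faithful_action (opposite_group (AutoGroup klein_bottle_group))
             (left_orders klein_bottle_group)
             (left_order_action klein_bottle_group) \<and>
         \<not> faithful_action (opposite_group (OutGroup klein_bottle_group))
             (bi_orders klein_bottle_group)
             (induced_action (bi_order_action klein_bottle_group)) \<and>
         \<not> faithful_action (opposite_group (OutGroup klein_bottle_group))
             (order_conj_classes klein_bottle_group)
             (induced_action (conj_class_action klein_bottle_group))"
proof -
  let ?K = klein_bottle_group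
  interpret K: group ?K by (rule group_klein_bottle_group)
  define x y where "x = klein_class [(X, True)]" and "y = klein_class [(Y, True)]"
  define \<phi> where "\<phi> = (\<lambda>g\<in>carrier ?K. if odd_class X g then g \<otimes>\<^bsub>?K\<^esub> y else g)"
  have xy: "x \<in> carrier ?K" "y \<in> carrier ?K"
    by (simp_all add: x_def y_def klein_carrier)
  have par: "odd_class X x" "\<not> odd_class Y x" "\<not> odd_class X y" "odd_class Y y"
    by (simp_all add: x_def y_def odd_class_klein) (simp_all add: odd_count_def)
  have even: "y \<otimes>\<^bsub>?K\<^esub> g = g \<otimes>\<^bsub>?K\<^esub> y" if g: "g \<in> carrier ?K" "\<not> odd_class X g" for g
  proof -
    obtain w where w: "g = klein_class w" using g(1) unfolding klein_carrier by blast
    then have "\<not> odd_count X w" using g(2) by (simp add: odd_class_klein)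
    then show ?thesis
      using klein_move_Y[of True w] by (simp add: w y_def klein_mult word_class_eq_iff)
  qed
  have odd: "y \<otimes>\<^bsub>?K\<^esub> g \<otimes>\<^bsub>?K\<^esub> y = g" if g: "g \<in> carrier ?K" "odd_class X g" for g
  proof -
    obtain w where w: "g = klein_class w" using g(1) unfolding klein_carrier by blast
    then have "odd_count X w" using g(2) by (simp add: odd_class_klein)
    \<comment> \<open>The leading y arrives at the end as y^-1, where the final y cancels
      it.\<close>
    then have "word_eq klein_rels ((Y, True) # w @ [(Y, True)]) (w @ [(Y, False), (Y, True)])"
      using word_eq_context[OF klein_move_Y[of True w], of "[]" "[(Y, True)]"] by simp
    moreover have "word_eq klein_rels (w @ [(Y, False), (Y, True)]) w"
      using word_eq.cancel[of _ w Y False "[]"] by simp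
    ultimately show ?thesis
      by (auto simp: w y_def klein_mult word_class_eq_iff intro: word_eq.trans)
  qed
  have auto: "\<phi> \<in> auto ?K"
    unfolding \<phi>_def by (rule K.parity_twist(1)[OF xy(2) par(3) odd_class_mult even odd])
  have sq: "\<phi> g \<otimes>\<^bsub>?K\<^esub> \<phi> g = g \<otimes>\<^bsub>?K\<^esub> g" if "g \<in> carrier ?K" for g
    unfolding \<phi>_def by (rule K.parity_twist(2)[OF xy(2) par(3) odd_class_mult even odd that])
  have outer: "\<phi> \<notin> inner_auto ?K ` carrier ?K"
  proof
    assume "\<phi> \<in> inner_auto ?K ` carrier ?K"
    then obtain g where g: "g \<in> carrier ?K" "\<phi> = inner_auto ?K g" by auto
    have "g \<otimes>\<^bsub>?K\<^esub> x \<otimes>\<^bsub>?K\<^esub> inv\<^bsub>?K\<^esub> g = \<phi> x" using g xy by (simp add: inner_auto_def)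
    also have "\<dots> = x \<otimes>\<^bsub>?K\<^esub> y" using xy par by (simp add: \<phi>_def)
    \<comment> \<open>Clearing the inverse leaves only products, on which parity is additive. The
      two sides then differ by the y-parity of \<open>y\<close>, which is odd.\<close>
    finally have "g \<otimes>\<^bsub>?K\<^esub> x = x \<otimes>\<^bsub>?K\<^esub> y \<otimes>\<^bsub>?K\<^esub> g"
      using g xy by (metis K.inv_closed K.inv_solve_right K.m_closed)
    then have "odd_class Y (g \<otimes>\<^bsub>?K\<^esub> x) = odd_class Y (x \<otimes>\<^bsub>?K\<^esub> y \<otimes>\<^bsub>?K\<^esub> g)" by simp
    then show False using g xy par by (simp add: odd_class_mult)
  qed
  show ?thesis
    using K.order_actions_not_faithful[OF auto outer K.pull_order_square_preserving[OF auto sq]]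
    by blast
qed

end
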